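(* Let $\alpha,\beta$ be real numbers with $0\le\alpha\le\beta$. Let $(p_n)_{n\ge 1}$ and $(q_n)_{n\ge 1}$ be real sequences with $q_n\in(0,1)$ and $p_n\in(q_n,1]$ for all $n$, such that $\lim_{n\to\infty}p_n=1$, $\lim_{n\to\infty}q_n=1$, $\lim_{n\to\infty}p_n^n=1$ and $\lim_{n\to\infty}q_n^n=1$. Let $S_{n,p_n,q_n}$ be the $(p,q)$-Bernstein-Stancu operators with parameters $\alpha,\beta$, taken with $p=p_n$ and $q=q_n$. Then for every $f\in C[0,1]$, $$st\text{-}\lim_{n}\ \|S_{n,p_n,q_n}(f;\cdot)-f\|=0 .$$
   Context: $C[0,1]$ is the space of real-valued continuous functions on $[0,1]$ with the norm $\|f\|=\sup_{x\in[0,1]}|f(x)|$. For $0<q<p\le 1$ and an integer $n\ge 0$, the $(p,q)$-integer is $[n]_{p,q}=p^{n-1}+p^{n-2}q+\cdots+pq^{n-2}+q^{n-1}=\frac{p^n-q^n}{p-q}$ (so $[0]_{p,q}=0$). The $(p,q)$-factorial is $[0]_{p,q}!=1$ and $[n]_{p,q}!=[1]_{p,q}[2]_{p,q}\cdots[n]_{p,q}$ for $n\ge1$. The $(p,q)$-binomial coefficient is $\binom{n}{k}_{p,q}=\frac{[n]_{p,q}!}{[k]_{p,q}!\,[n-k]_{p,q}!}$ for $0\le k\le n$. For $n\ge 1$, real numbers $\alpha,\beta$ with $0\le\alpha\le\beta$, and $f\in C[0,1]$, the $(p,q)$-Bernstein-Stancu operator is $$S_{n,p,q}(f;x)=\frac{1}{p^{n(n-1)/2}}\sum_{k=0}^{n}\binom{n}{k}_{p,q}p^{k(k-1)/2}x^k\prod_{s=0}^{n-k-1}(p^s-q^sx)\;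 f\!\left(\frac{p^{n-k}[k]_{p,q}+\alpha}{[n]_{p,q}+\beta}\right),\qquad x\in[0,1],$$ where an empty product equals $1$ and $x^0=1$. Statistical convergence: a real sequence $(x_k)_{k\ge1}$ is statistically convergent to $L$, written $st\text{-}\lim_k x_k=L$, if for every $\varepsilon>0$, $\lim_{n\to\infty}\frac1n\left|\{k\le n:\ |x_k-L|\ge\varepsilon\}\right|=0$, where $|\cdot|$ applied to a set denotes its cardinality. *)

theory Defs
  imports "HOL-Analysis.Analysis"
begin

definition pq_int :: "real \<Rightarrow> real \<Rightarrow> nat \<Rightarrow> real" where
  "pq_int p q n = (\<Sum>i<n. p ^ (n - 1 - i) * q ^ i)"

lemma pq_int_closed_form:
  assumes "p \<noteq> q"
  shows "pq_int p q n = (p ^ n - q ^ n) / (p - q)"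
  using assms power_diff_sumr2[of q n p] by (simp add: pq_int_def field_simps)

definition pq_fact :: "real \<Rightarrow> real \<Rightarrow> nat \<Rightarrow> real" where
  "pq_fact p q n = (\<Prod>i=1..n. pq_int p q i)"

definition pq_binomial :: "real \<Rightarrow> real \<Rightarrow> nat \<Rightarrow> nat \<Rightarrow> real" where
  "pq_binomial p q n k = pq_fact p q n / (pq_fact p q k * pq_fact p q (n - k))"

definition bernstein_stancu ::
    "real \<Rightarrow> real \<Rightarrow> real \<Rightarrow> real \<Rightarrow> nat \<Rightarrow> (real \<Rightarrow> real) \<Rightarrow> real \<Rightarrow> real" where
  "bernstein_stancu \<alpha> \<beta> p q n f x =
     1 / p ^ (n * (n - 1) div 2) *
     (\<Sum>k\<le>n. pq_binomial p q n k * p ^ (k * (k - 1) div 2) * x ^ k *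
        (\<Prod>s<n - k. p ^ s - q ^ s * x) *
        f ((p ^ (n - k) * pq_int p q k + \<alpha>) / (pq_int p q n + \<beta>)))"

text \<open>
  Elements of \<open>C[0,1]\<close> are represented by functions on the reals that are continuous on the
  unit interval; their values outside the interval never matter. The supremum below is that of
  a nonempty bounded set whenever \<open>g\<close> is continuous on the unit interval.
\<close>
definition sup_norm01 :: "(real \<Rightarrow> real) \<Rightarrow> real" where
  "sup_norm01 g = (SUP x\<in>{0..1}. \<bar>g x\<bar>)"

text \<open>Sequences are indexed from 1; the value at index 0 is ignored.\<close>
definition stat_convergent_to :: "(nat \<Rightarrow> real) \<Rightarrow> real \<Rightarrow> bool" where
  "stat_convergent_to u L \<longleftrightarrow>
     (\<forall>\<epsilon>>0. (\<lambda>n. 1 / real n * real (card {k \<in> {1..n}. \<bar>u k - L\<bar> \<ge> \<epsilon>})) \<longlonglongrightarrow> 0)"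

end

theory Submission
  imports Defs
begin

text \<open>
  Dividing out powers of \<open>p\<close> turns the \<open>(p,q)\<close>-Bernstein weights into the Phillips weights
  of the single ratio \<open>r = q / p\<close>. These are nonnegative on the unit interval and have total mass 1
  (lemma \<open>q_weight_sum\<close>), so the operator averages values of \<open>f\<close>. With respect to the nodes
  \<open>[k]\<^sub>r / [n]\<^sub>r\<close> the average has mean \<open>x\<close> and variance \<open>x (1 - x) / [n]\<^sub>r\<close>
  (lemma \<open>q_weight_variance\<close>), while the Stancu shift moves every node by at most
  \<open>\<beta> / [n]\<^sub>p\<^sub>,\<^sub>q\<close>. Hence the averaged squared distance from the nodes to \<open>x\<close> is bounded, uniformly in
  \<open>x\<close>, by a quantity that vanishes as \<open>[n]\<^sub>p\<^sub>,\<^sub>q\<close> grows, and Chebyshev's argument with uniform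
  continuity of \<open>f\<close> bounds the error in the supremum norm (lemma \<open>bernstein_stancu_error\<close>).

  Every one of the \<open>n\<close> summands of \<open>[n]\<^sub>p\<^sub>,\<^sub>q\<close> is at least \<open>q ^ n\<close>, so
  \<open>q n ^ n \<longlonglongrightarrow> 1\<close> forces it to infinity. The norms therefore converge to 0 in the ordinary sense,
  which implies statistical convergence because only finitely many indices are exceptional.
\<close>

section \<open>Statistical convergence\<close>

lemma LIMSEQ_imp_stat_convergent_to:
  assumes "u \<longlonglongrightarrow> L"
  shows "stat_convergent_to u L"
  unfolding stat_convergent_to_def
proof (intro allI impI)
  fix e :: real assume "e > 0"
  then obtain N where N: "\<And>k. k \<ge> N \<Longrightarrow> \<bar>u k - L\<bar> < e"
    using LIMSEQ_D[OF assms] by (auto simp: real_norm_def)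
  have "card {k \<in> {1..n}. \<bar>u k - L\<bar> \<ge> e} \<le> N" for n
  proof -
    have "{k \<in> {1..n}. \<bar>u k - L\<bar> \<ge> e} \<subseteq> {..<N}"
      using N by (force simp: not_less[symmetric])
    from card_mono[OF _ this] show ?thesis by simp
  qed
  then have le: "1 / real n * real (card {k \<in> {1..n}. \<bar>u k - L\<bar> \<ge> e}) \<le> 1 / real n * real N" for n
    by (intro mult_left_mono) auto
  have "(\<lambda>n. 1 / real n * real N) \<longlonglongrightarrow> 0"
    by (rule tendsto_mult_left_zero[OF lim_1_over_n])
  then show "(\<lambda>n. 1 / real n * real (card {k \<in> {1..n}. \<bar>u k - L\<bar> \<ge> e})) \<longlonglongrightarrow> 0"
    by (rule tendsto_sandwich[OF always_eventually always_eventually tendsto_const, rotated -1])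
      (use le in simp_all)
qed

section \<open>Integers and binomial coefficients of a single base\<close>

abbreviation q_int :: "real \<Rightarrow> nat \<Rightarrow> real" where
  "q_int r n \<equiv> pq_int 1 r n"

lemma q_int_add: "q_int r (m + n) = q_int r m + r ^ m * q_int r n"
  by (induction n) (auto simp: pq_int_def algebra_simps power_add)

lemma q_int_simps [simp]: "q_int r 0 = 0" "q_int r (Suc 0) = 1"
  by (simp_all add: pq_int_def)

lemma q_int_Suc: "q_int r (Suc n) = 1 + r * q_int r n"
  using q_int_add[of r 1 n] by simp

lemma q_int_nonneg: "r > 0 \<Longrightarrow> q_int r n \<ge> 0"
  by (auto simp: pq_int_def intro!: sum_nonneg)

lemma q_int_pos: "r > 0 \<Longrightarrow> q_int r (Suc n) > 0"
  using q_int_nonneg[of r n] by (simp add: q_int_Suc add_pos_nonneg)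

lemma q_int_mono: "r > 0 \<Longrightarrow> k \<le> n \<Longrightarrow> q_int r k \<le> q_int r n"
  by (auto simp: pq_int_def intro!: sum_mono2)

lemma pq_fact_Suc: "pq_fact p q (Suc n) = pq_int p q (Suc n) * pq_fact p q n"
  by (simp add: pq_fact_def)

lemma pq_fact_0 [simp]: "pq_fact p q 0 = 1"
  by (simp add: pq_fact_def)

lemma q_fact_pos: "r > 0 \<Longrightarrow> pq_fact 1 r n > 0"
  by (induction n) (auto simp: pq_fact_Suc q_int_pos)

lemma q_binomial_absorption:
  assumes "r > 0"
  shows "q_int r (Suc k) * pq_binomial 1 r (Suc n) (Suc k) = q_int r (Suc n) * pq_binomial 1 r n k"
  using q_int_pos[OF assms, of k] q_fact_pos[OF assms]
  by (simp add: pq_binomial_def pq_fact_Suc)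

lemma q_binomial_0 [simp]: "r > 0 \<Longrightarrow> pq_binomial 1 r n 0 = 1"
  and q_binomial_self [simp]: "r > 0 \<Longrightarrow> pq_binomial 1 r n n = 1"
  using q_fact_pos[of r n] by (simp_all add: pq_binomial_def)

text \<open>
  The Pascal rule comes from the splitting \<open>[n + 1] = [k + 1] + r ^ (k + 1) [n - k]\<close>.
\<close>
lemma q_binomial_Pascal:
  assumes "r > 0" "k < n"
  shows "pq_binomial 1 r (Suc n) (Suc k) = pq_binomial 1 r n k + r ^ Suc k * pq_binomial 1 r n (Suc k)"
proof -
  obtain m where n: "n = Suc (k + m)"
    using \<open>k < n\<close> less_iff_Suc_add by auto
  let ?F = "pq_fact 1 r"
  have split: "q_int r (Suc n) = q_int r (Suc k) + r ^ Suc k * q_int r (Suc m)"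
    using q_int_add[of r "Suc k" "Suc m"] by (simp add: n)
  have pos: "?F k > 0" "?F m > 0" "q_int r (Suc k) > 0" "q_int r (Suc m) > 0"
    using assms(1) by (auto simp: q_fact_pos q_int_pos)
  have "pq_binomial 1 r (Suc n) (Suc k)
      = q_int r (Suc n) * (?F n / (q_int r (Suc k) * ?F k * (q_int r (Suc m) * ?F m)))"
    by (simp add: pq_binomial_def pq_fact_Suc n)
  also have "\<dots> = ?F n / (?F k * (q_int r (Suc m) * ?F m))
      + r ^ Suc k * (?F n / (q_int r (Suc k) * ?F k * ?F m))"
    unfolding split using pos by (simp add: field_simps del: power_Suc)
  also have "\<dots> = pq_binomial 1 r n k + r ^ Suc k * pq_binomial 1 r n (Suc k)"
    by (simp add: pq_binomial_def pq_fact_Suc n)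
  finally show ?thesis .
qed

section \<open>Moments of the Phillips weights\<close>

text \<open>
  Extending by zero beyond \<open>n\<close> lets the recursion \<open>q_weight_Suc\<close> hold at \<open>k = n\<close> as well.
\<close>
definition q_weight :: "real \<Rightarrow> nat \<Rightarrow> nat \<Rightarrow> real \<Rightarrow> real" where
  "q_weight r n k x =
     (if k \<le> n then pq_binomial 1 r n k * x ^ k * (\<Prod>s<n - k. 1 - r ^ s * x) else 0)"

lemma q_weight_nonneg:
  assumes "0 < r" "r \<le> 1" "0 \<le> x" "x \<le> 1"
  shows "q_weight r n k x \<ge> 0"
proof -
  have "r ^ s * x \<le> 1" for s
    using assms mult_le_one[of "r ^ s" x] by (simp add: power_le_one)
  moreover have "pq_binomial 1 r n k \<ge> 0"
    using q_fact_pos[OF assms(1)] by (simp add: pq_binomial_def less_imp_le)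
  ultimately show ?thesis
    using assms by (auto simp: q_weight_def intro!: mult_nonneg_nonneg prod_nonneg)
qed

text \<open>
  Separating the factor \<open>s = 0\<close> leaves a product of the same shape at the argument \<open>r x\<close>, and the power
  of \<open>r\<close> in the Pascal rule turns \<open>x ^ k\<close> into \<open>(r x) ^ k\<close>.
\<close>
lemma prod_shift_argument:
  fixes r x :: real
  shows "(\<Prod>s<Suc m. 1 - r ^ s * x) = (1 - x) * (\<Prod>s<m. 1 - r ^ s * (r * x))"
  by (subst prod.lessThan_Suc_shift) (simp add: mult_ac)

lemma q_weight_Suc_0:
  assumes "r > 0"
  shows "q_weight r (Suc n) 0 x = (1 - x) * q_weight r n 0 (r * x)"
  using assms prod_shift_argument[where m = n] by (simp add: q_weight_def del: prod.lessThan_Suc)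

lemma q_weight_Suc:
  assumes "r > 0" "k \<le> n"
  shows "q_weight r (Suc n) (Suc k) x = x * q_weight r n k x + (1 - x) * q_weight r n (Suc k) (r * x)"
proof (cases "k = n")
  case True
  then show ?thesis using assms by (simp add: q_weight_def)
next
  case False
  then obtain m where n: "n = Suc (k + m)"
    using \<open>k \<le> n\<close> less_iff_Suc_add by (metis le_neq_implies_less)
  let ?P = "\<Prod>s<Suc m. 1 - r ^ s * x"
  have "q_weight r (Suc n) (Suc k) x
      = (pq_binomial 1 r n k + r ^ Suc k * pq_binomial 1 r n (Suc k)) * x ^ Suc k * ?P"
    using q_binomial_Pascal[OF assms(1), of k n] by (simp add: q_weight_def n)
  also have "\<dots> = x * (pq_binomial 1 r n k * x ^ k * ?P)
      + pq_binomial 1 r n (Suc k) * (r * x) ^ Suc k * ?P"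
    by (simp add: algebra_simps power_mult_distrib del: prod.lessThan_Suc)
  also have "\<dots> = x * q_weight r n k x + (1 - x) * q_weight r n (Suc k) (r * x)"
    using prod_shift_argument[of r x m] by (simp add: q_weight_def n del: prod.lessThan_Suc)
  finally show ?thesis .
qed

text \<open>
  By the recursion, the total mass at \<open>x\<close> is the combination of the masses for \<open>n - 1\<close> at \<open>x\<close> and
  at \<open>r x\<close> with coefficients \<open>x\<close> and \<open>1 - x\<close>. For this induction the claim has to cover all real \<open>x\<close>.
\<close>
lemma q_weight_sum:
  assumes "r > 0"
  shows "(\<Sum>k\<le>n. q_weight r n k x) = 1"
proof (induction n arbitrary: x)
  case 0
  then show ?case using assms by (simp add: q_weight_def)
next
  case (Suc n)
  have "(\<Sum>k\<le>Suc n. q_weight r (Suc n) k x)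
      = (1 - x) * q_weight r n 0 (r * x)
        + (\<Sum>k\<le>n. x * q_weight r n k x + (1 - x) * q_weight r n (Suc k) (r * x))"
    using assms by (subst sum.atMost_Suc_shift) (simp add: q_weight_Suc_0 q_weight_Suc)
  also have "\<dots> = x * (\<Sum>k\<le>n. q_weight r n k x) + (1 - x) * (\<Sum>k\<le>Suc n. q_weight r n k (r * x))"
    unfolding sum.atMost_Suc_shift[of "\<lambda>k. q_weight r n k (r * x)"] sum.distrib
      sum_distrib_left[symmetric]
    by (simp only: distrib_left add_ac)
  also have "(\<Sum>k\<le>Suc n. q_weight r n k (r * x)) = (\<Sum>k\<le>n. q_weight r n k (r * x))"
    by (simp add: q_weight_def)
  finally show ?case by (simp add: Suc.IH)
qed

text \<open>
  Multiplying the weight by \<open>[k]\<close> lowers both indices, by absorption; so each moment reduces to lower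
  moments for \<open>n - 1\<close>.
\<close>
lemma sum_q_int_times_q_weight:
  assumes "r > 0"
  shows "(\<Sum>k\<le>Suc n. q_weight r (Suc n) k x * (q_int r k * h k))
       = q_int r (Suc n) * x * (\<Sum>k\<le>n. q_weight r n k x * h (Suc k))"
proof -
  have "q_weight r (Suc n) (Suc k) x * (q_int r (Suc k) * h (Suc k))
      = q_int r (Suc n) * x * (q_weight r n k x * h (Suc k))" if "k \<le> n" for k
  proof -
    have "q_weight r (Suc n) (Suc k) x * (q_int r (Suc k) * h (Suc k))
        = (q_int r (Suc k) * pq_binomial 1 r (Suc n) (Suc k))
          * (x ^ Suc k * (\<Prod>s<n - k. 1 - r ^ s * x) * h (Suc k))"
      using that by (simp add: q_weight_def)
    then show ?thesis
      using that by (simp add: q_binomial_absorption[OF assms] q_weight_def)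
  qed
  then have "(\<Sum>k\<le>n. q_weight r (Suc n) (Suc k) x * (q_int r (Suc k) * h (Suc k)))
      = (\<Sum>k\<le>n. q_int r (Suc n) * x * (q_weight r n k x * h (Suc k)))"
    by (intro sum.cong) auto
  then show ?thesis
    by (simp add: sum.atMost_Suc_shift sum_distrib_left del: sum.atMost_Suc)
qed

lemma q_weight_first_moment:
  assumes "r > 0"
  shows "(\<Sum>k\<le>n. q_weight r n k x * q_int r k) = q_int r n * x"
proof (cases n)
  case (Suc m)
  then show ?thesis
    using sum_q_int_times_q_weight[OF assms, of m x "\<lambda>_. 1"] q_weight_sum[OF assms] by simp
qed simp

lemma q_weight_second_moment:
  assumes "r > 0"
  shows "(\<Sum>k\<le>Suc m. q_weight r (Suc m) k x * (q_int r k)\<^sup>2)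
       = q_int r (Suc m) * x * (1 + r * (q_int r m * x))"
proof -
  have "(\<Sum>k\<le>m. q_weight r m k x * q_int r (Suc k))
      = (\<Sum>k\<le>m. q_weight r m k x) + r * (\<Sum>k\<le>m. q_weight r m k x * q_int r k)"
    by (simp add: q_int_Suc algebra_simps sum.distrib sum_distrib_left)
  then show ?thesis
    using sum_q_int_times_q_weight[OF assms, of m x "q_int r"]
    by (simp add: power2_eq_square q_weight_sum[OF assms] q_weight_first_moment[OF assms])
qed

text \<open>The two moments combine to \<open>x (1 - x) / [n]\<close> because \<open>1 + r [n - 1] = [n]\<close>.\<close>
lemma q_weight_variance:
  assumes "r > 0" "n \<ge> 1"
  shows "(\<Sum>k\<le>n. q_weight r n k x * (q_int r k / q_int r n - x)\<^sup>2) = x * (1 - x) / q_int r n"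
proof -
  obtain m where n: "n = Suc m"
    using assms(2) by (cases n) auto
  define N where "N = q_int r n"
  have N: "N > 0" "r * q_int r m = N - 1"
    using q_int_pos[OF assms(1)] by (simp_all add: N_def n q_int_Suc)
  have "(\<Sum>k\<le>n. q_weight r n k x * (q_int r k / N - x)\<^sup>2)
      = (\<Sum>k\<le>n. q_weight r n k x * (q_int r k)\<^sup>2) / N\<^sup>2
        - 2 * x / N * (\<Sum>k\<le>n. q_weight r n k x * q_int r k) + x\<^sup>2 * (\<Sum>k\<le>n. q_weight r n k x)"
    by (simp add: power2_diff power_divide sum_distrib_left sum_divide_distrib
        sum.distrib[symmetric] sum_subtractf[symmetric] algebra_simps)
  also have "\<dots> = N * x * (1 + (r * q_int r m) * x) / N\<^sup>2 - 2 * x / N * (N * x) + x\<^sup>2"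
    unfolding N_def n q_weight_sum[OF assms(1)] q_weight_first_moment[OF assms(1)]
      q_weight_second_moment[OF assms(1)] by (simp add: mult_ac)
  also have "\<dots> = x * (1 - x) / N"
    unfolding N(2) using N(1) by (simp add: field_simps power2_eq_square)
  finally show ?thesis by (simp add: N_def)
qed

section \<open>Reduction of two parameters to their ratio\<close>

lemma pq_int_Suc_ratio:
  assumes "p > 0"
  shows "pq_int p q (Suc m) = p ^ m * q_int (q / p) (Suc m)"
proof -
  have "p ^ (m - i) * q ^ i = p ^ m * (q / p) ^ i" if "i \<le> m" for i
    using assms that by (simp add: power_divide power_diff)
  then show ?thesis
    by (simp add: pq_int_def sum_distrib_left less_Suc_eq_le del: sum.lessThan_Suc)
qed

lemma triangle_Suc: "Suc n * (Suc n - 1) div 2 = n * (n - 1) div 2 + (n::nat)"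
  by (cases n) auto

lemma pq_fact_ratio:
  assumes "p > 0"
  shows "pq_fact p q n = p ^ (n * (n - 1) div 2) * pq_fact 1 (q / p) n"
proof (induction n)
  case (Suc n)
  show ?case
    unfolding pq_fact_Suc triangle_Suc power_add pq_int_Suc_ratio[OF assms] Suc.IH by simp
qed simp

lemma prod_ratio:
  fixes p q x :: real
  assumes "p > 0"
  shows "(\<Prod>s<m. p ^ s - q ^ s * x) = p ^ (m * (m - 1) div 2) * (\<Prod>s<m. 1 - (q / p) ^ s * x)"
proof (induction m)
  case (Suc m)
  have "p ^ m - q ^ m * x = p ^ m * (1 - (q / p) ^ m * x)"
    using assms by (simp add: power_divide field_simps)
  then show ?case
    unfolding triangle_Suc power_add prod.lessThan_Suc Suc.IH by simp
qed simp

text \<open>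
  Each factorial and the final product contribute a power of \<open>p\<close> with triangular exponent. The two
  explicit powers of \<open>p\<close> in the operator are exactly what cancels these contributions.
\<close>
lemma pq_weight_ratio:
  assumes "p > 0" "k \<le> n"
  shows "1 / p ^ (n * (n - 1) div 2) * (pq_binomial p q n k * p ^ (k * (k - 1) div 2) * x ^ k *
           (\<Prod>s<n - k. p ^ s - q ^ s * x)) = q_weight (q / p) n k x"
proof -
  have cancel: "1 / A * (A * F / (B * G * (D * H)) * B * X * (D * P)) = F / (G * H) * X * P"
    if "A \<noteq> 0" "B \<noteq> 0" "D \<noteq> 0" for A B D F G H X P :: real
    using that by simp
  show ?thesis
    unfolding pq_binomial_def pq_fact_ratio[OF assms(1), of q] prod_ratio[OF assms(1)]
    using assms by (subst cancel) (simp_all add: q_weight_def pq_binomial_def)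
qed

lemma pq_node_ratio:
  assumes "p > 0" "q > 0" "k \<le> n" "n \<ge> 1"
  shows "p ^ (n - k) * pq_int p q k = pq_int p q n * (q_int (q / p) k / q_int (q / p) n)"
proof -
  obtain m where n: "n = Suc m"
    using assms(4) by (cases n) auto
  have pos: "q_int (q / p) (Suc m) > 0"
    using assms q_int_pos by simp
  show ?thesis
  proof (cases k)
    case 0
    then show ?thesis by (simp add: pq_int_def)
  next
    case (Suc j)
    have "p ^ (m - j) * p ^ j = p ^ m"
      using Suc assms(3) n by (simp add: power_add[symmetric])
    then show ?thesis
      using pos unfolding n Suc pq_int_Suc_ratio[OF assms(1)] by (simp add: mult.assoc[symmetric])
  qed
qed

lemma bernstein_stancu_eq_q_weight:
  assumes "0 < p" "0 < q" "n \<ge> 1"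
  shows "bernstein_stancu \<alpha> \<beta> p q n f x =
    (\<Sum>k\<le>n. q_weight (q / p) n k x *
       f ((pq_int p q n * (q_int (q / p) k / q_int (q / p) n) + \<alpha>) / (pq_int p q n + \<beta>)))"
  unfolding bernstein_stancu_def sum_distrib_left
proof (intro sum.cong refl)
  fix k assume "k \<in> {..n}"
  then have k: "k \<le> n"
    by simp
  show "1 / p ^ (n * (n - 1) div 2) * (pq_binomial p q n k * p ^ (k * (k - 1) div 2) * x ^ k *
        (\<Prod>s<n - k. p ^ s - q ^ s * x) *
        f ((p ^ (n - k) * pq_int p q k + \<alpha>) / (pq_int p q n + \<beta>)))
      = q_weight (q / p) n k x *
        f ((pq_int p q n * (q_int (q / p) k / q_int (q / p) n) + \<alpha>) / (pq_int p q n + \<beta>))"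
    unfolding pq_weight_ratio[OF assms(1) k, symmetric] pq_node_ratio[OF assms(1,2) k assms(3)]
    by (simp only: mult.assoc)
qed

section \<open>Uniform error of the operator\<close>

text \<open>
  The usual Chebyshev device: near \<open>x\<close> uniform continuity controls the difference, and away from
  \<open>x\<close> the quadratic term dominates the trivial bound by twice the maximum of \<open>\<bar>f\<bar>\<close>.
\<close>
lemma continuous_quadratic_bound:
  fixes f :: "real \<Rightarrow> real"
  assumes "continuous_on {0..1} f" "e > 0"
  obtains C where "C \<ge> 0"
    "\<And>x y. x \<in> {0..1} \<Longrightarrow> y \<in> {0..1} \<Longrightarrow> \<bar>f y - f x\<bar> \<le> e + C * (y - x)\<^sup>2"
proof -
  obtain d where d: "d > 0"
    "\<And>x y. x \<in> {0..1} \<Longrightarrow> y \<in> {0..1} \<Longrightarrow> \<bar>y - x\<bar> < d \<Longrightarrow> \<bar>f y - f x\<bar> < e"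
    using compact_uniformly_continuous[OF assms(1)] assms(2)
    unfolding uniformly_continuous_on_def by (auto simp: dist_real_def)
  have "bounded (f ` {0..1})"
    using assms(1) by (intro compact_imp_bounded compact_continuous_image) auto
  then obtain M where M: "\<And>x. x \<in> {0..1} \<Longrightarrow> \<bar>f x\<bar> \<le> M"
    unfolding bounded_iff real_norm_def by blast
  have M0: "M \<ge> 0"
    using M[of 0] by simp
  show ?thesis
  proof
    show "2 * M / d\<^sup>2 \<ge> 0"
      using M0 by simp
    fix x y :: real assume xy: "x \<in> {0..1}" "y \<in> {0..1}"
    show "\<bar>f y - f x\<bar> \<le> e + 2 * M / d\<^sup>2 * (y - x)\<^sup>2"
    proof (cases "\<bar>y - x\<bar> < d")
      case True
      moreover have "2 * M / d\<^sup>2 * (y - x)\<^sup>2 \<ge> 0"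
        using M0 by simp
      ultimately show ?thesis
        using d(2)[OF xy] by linarith
    next
      case False
      then have "1 \<le> (y - x)\<^sup>2 / d\<^sup>2"
        using d(1) power_mono[of d "\<bar>y - x\<bar>" 2] by simp
      then have "2 * M \<le> 2 * M / d\<^sup>2 * (y - x)\<^sup>2"
        using M0 mult_left_mono[of 1 "(y - x)\<^sup>2 / d\<^sup>2" "2 * M"] by simp
      moreover have "\<bar>f y - f x\<bar> \<le> 2 * M"
        using M[OF xy(1)] M[OF xy(2)] by linarith
      ultimately show ?thesis
        using assms(2) by linarith
    qed
  qed
qed

text \<open>
  The condition \<open>\<alpha> \<le> \<beta>\<close> keeps the shifted node in the unit interval, where \<open>f\<close> is
  continuous. The shift has numerator \<open>\<alpha> - \<beta> t\<close>, whose modulus is at most \<open>\<beta>\<close>.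
\<close>
lemma stancu_node:
  fixes t N \<alpha> \<beta> :: real
  assumes "0 \<le> t" "t \<le> 1" "0 < N" "0 \<le> \<alpha>" "\<alpha> \<le> \<beta>"
  shows "(N * t + \<alpha>) / (N + \<beta>) \<in> {0..1}"
    and "\<bar>(N * t + \<alpha>) / (N + \<beta>) - t\<bar> \<le> \<beta> / N"
proof -
  have "N * t \<le> N"
    using assms by simp
  then show "(N * t + \<alpha>) / (N + \<beta>) \<in> {0..1}"
    using assms by (simp add: add_mono)
  have bt: "0 \<le> \<beta> * t" "\<beta> * t \<le> \<beta>"
    using assms by (auto simp: mult_left_le)
  have "(N * t + \<alpha>) / (N + \<beta>) - t = (\<alpha> - \<beta> * t) / (N + \<beta>)"
    using assms by (simp add: field_simps)
  then have "\<bar>(N * t + \<alpha>) / (N + \<beta>) - t\<bar> = \<bar>\<alpha> - \<beta> * t\<bar> / (N + \<beta>)"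
    using assms by simp
  also have "\<bar>\<alpha> - \<beta> * t\<bar> \<le> \<beta>"
    using assms bt by linarith
  then have "\<bar>\<alpha> - \<beta> * t\<bar> / (N + \<beta>) \<le> \<beta> / N"
    using assms by (intro frac_le) auto
  finally show "\<bar>(N * t + \<alpha>) / (N + \<beta>) - t\<bar> \<le> \<beta> / N" .
qed

text \<open>
  The squared distance from \<open>x\<close> to a shifted node is at most twice the squared shift plus twice the
  squared distance to the unshifted node; averaging leaves the shift bound and the variance.
\<close>
lemma bernstein_stancu_error:
  fixes f :: "real \<Rightarrow> real"
  assumes ab: "0 \<le> \<alpha>" "\<alpha> \<le> \<beta>" and pq: "0 < q" "q < p" "p \<le> 1" and n: "n \<ge> 1"
    and C: "C \<ge> 0" "\<And>x y. x \<in> {0..1} \<Longrightarrow> y \<in> {0..1} \<Longrightarrow> \<bar>f y - f x\<bar> \<le> e + C * (y - x)\<^sup>2"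
    and x: "x \<in> {0..1}"
  shows "\<bar>bernstein_stancu \<alpha> \<beta> p q n f x - f x\<bar>
      \<le> e + C * (2 * (\<beta> / pq_int p q n)\<^sup>2 + 2 / pq_int p q n)"
proof -
  define r where "r = q / p"
  define N where "N = pq_int p q n"
  define t where "t k = q_int r k / q_int r n" for k
  define y where "y k = (N * t k + \<alpha>) / (N + \<beta>)" for k
  define w where "w k = q_weight r n k x" for k
  have p: "p > 0"
    using pq by simp
  have r: "0 < r" "r \<le> 1"
    using pq by (auto simp: r_def)
  obtain m where m: "n = Suc m"
    using n by (cases n) auto
  have Q: "q_int r n > 0"
    using q_int_pos[OF r(1)] m by simp
  have NQ: "N = p ^ m * q_int r n"
    using pq_int_Suc_ratio[OF p] by (simp add: N_def m r_def)
  have N: "0 < N" "N \<le> q_int r n"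
    using Q p pq(3) by (auto simp: NQ mult_left_le_one_le power_le_one)
  have w0: "w k \<ge> 0" for k
    using r x by (auto simp: w_def q_weight_nonneg)
  have w1: "(\<Sum>k\<le>n. w k) = 1"
    unfolding w_def by (rule q_weight_sum[OF r(1)])
  have t: "0 \<le> t k" "t k \<le> 1" if "k \<le> n" for k
    using that Q q_int_nonneg[OF r(1)] q_int_mono[OF r(1)] by (auto simp: t_def)
  have y: "y k \<in> {0..1}" "(y k - x)\<^sup>2 \<le> 2 * (\<beta> / N)\<^sup>2 + 2 * (t k - x)\<^sup>2" if "k \<le> n" for k
  proof -
    show "y k \<in> {0..1}"
      unfolding y_def using stancu_node(1) t[OF that] N(1) ab by blast
    have "\<bar>y k - t k\<bar> \<le> \<beta> / N"
      unfolding y_def using stancu_node(2) t[OF that] N(1) ab by blast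
    then have "(y k - t k)\<^sup>2 \<le> (\<beta> / N)\<^sup>2"
      by (metis abs_ge_zero power2_abs power_mono)
    moreover have "(y k - x)\<^sup>2 \<le> 2 * (y k - t k)\<^sup>2 + 2 * (t k - x)\<^sup>2"
      using zero_le_power2[of "(y k - t k) - (t k - x)"] by (simp add: power2_eq_square algebra_simps)
    ultimately show "(y k - x)\<^sup>2 \<le> 2 * (\<beta> / N)\<^sup>2 + 2 * (t k - x)\<^sup>2"
      by linarith
  qed
  have "bernstein_stancu \<alpha> \<beta> p q n f x - f x = (\<Sum>k\<le>n. w k * f (y k)) - (\<Sum>k\<le>n. w k) * f x"
    using w1 bernstein_stancu_eq_q_weight[OF p pq(1) n]
    by (simp add: w_def y_def t_def N_def r_def)
  also have "\<dots> = (\<Sum>k\<le>n. w k * (f (y k) - f x))"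
    by (simp add: sum_distrib_right sum_subtractf right_diff_distrib)
  finally have "\<bar>bernstein_stancu \<alpha> \<beta> p q n f x - f x\<bar> \<le> (\<Sum>k\<le>n. \<bar>w k * (f (y k) - f x)\<bar>)"
    by simp
  also have "\<dots> \<le> (\<Sum>k\<le>n. w k * (e + C * (2 * (\<beta> / N)\<^sup>2 + 2 * (t k - x)\<^sup>2)))"
  proof (rule sum_mono)
    fix k assume "k \<in> {..n}"
    then have k: "k \<le> n"
      by simp
    have "\<bar>f (y k) - f x\<bar> \<le> e + C * (y k - x)\<^sup>2"
      using C(2) x y(1)[OF k] by blast
    also have "\<dots> \<le> e + C * (2 * (\<beta> / N)\<^sup>2 + 2 * (t k - x)\<^sup>2)"
      using mult_left_mono[OF y(2)[OF k] C(1)] by simp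
    finally show "\<bar>w k * (f (y k) - f x)\<bar> \<le> w k * (e + C * (2 * (\<beta> / N)\<^sup>2 + 2 * (t k - x)\<^sup>2))"
      using w0[of k] by (simp add: abs_mult mult_left_mono)
  qed
  also have "\<dots> = (\<Sum>k\<le>n. w k) * (e + C * (2 * (\<beta> / N)\<^sup>2)) + 2 * C * (\<Sum>k\<le>n. w k * (t k - x)\<^sup>2)"
    unfolding sum_distrib_left sum_distrib_right sum.distrib[symmetric]
    by (intro sum.cong refl) (simp add: algebra_simps)
  also have "(\<Sum>k\<le>n. w k * (t k - x)\<^sup>2) = x * (1 - x) / q_int r n"
    unfolding w_def t_def by (rule q_weight_variance[OF r(1) n])
  also have "(\<Sum>k\<le>n. w k) * (e + C * (2 * (\<beta> / N)\<^sup>2)) + 2 * C * (x * (1 - x) / q_int r n)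
      \<le> e + C * (2 * (\<beta> / N)\<^sup>2) + 2 * C * (1 / N)"
  proof -
    have "x * (1 - x) / q_int r n \<le> 1 / N"
      using x N by (intro frac_le) (auto intro: mult_le_one)
    from mult_left_mono[OF this, of "2 * C"] show ?thesis
      using C(1) w1 by simp
  qed
  finally show ?thesis
    by (simp add: N_def algebra_simps)
qed

lemma abs_sup_norm01_le:
  assumes "\<And>x. x \<in> {0..1} \<Longrightarrow> \<bar>g x\<bar> \<le> B"
  shows "\<bar>sup_norm01 g\<bar> \<le> B"
proof -
  have "bdd_above ((\<lambda>x. \<bar>g x\<bar>) ` {0..1})"
    using assms by (intro bdd_aboveI2) auto
  then have "\<bar>g 0\<bar> \<le> sup_norm01 g"
    unfolding sup_norm01_def by (intro cSUP_upper) auto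
  moreover have "sup_norm01 g \<le> B"
    unfolding sup_norm01_def using assms by (intro cSUP_least) auto
  ultimately show ?thesis by simp
qed

lemma pq_int_lower_bound:
  assumes "0 < q" "q \<le> p" "q \<le> 1"
  shows "real n * q ^ n \<le> pq_int p q n"
proof -
  have "q ^ n \<le> p ^ (n - 1 - i) * q ^ i" if "i < n" for i
  proof -
    have "q ^ n \<le> q ^ (n - 1)"
      using assms by (intro power_decreasing) auto
    also have "\<dots> = q ^ (n - 1 - i) * q ^ i"
      using that by (simp add: power_add[symmetric])
    also have "\<dots> \<le> p ^ (n - 1 - i) * q ^ i"
      using assms by (intro mult_right_mono power_mono) auto
    finally show ?thesis .
  qed
  then show ?thesis
    unfolding pq_int_def using sum_mono[of "{..<n}" "\<lambda>_. q ^ n"] by simp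
qed

theorem theorem3p4:
  fixes \<alpha> \<beta> :: real and p q :: "nat \<Rightarrow> real" and f :: "real \<Rightarrow> real"
  assumes "0 \<le> \<alpha>" and "\<alpha> \<le> \<beta>"
    and "\<And>n. n \<ge> 1 \<Longrightarrow> q n \<in> {0<..<1}"
    and "\<And>n. n \<ge> 1 \<Longrightarrow> p n \<in> {q n<..1}"
    and "p \<longlonglongrightarrow> 1" and "q \<longlonglongrightarrow> 1"
    and "(\<lambda>n. p n ^ n) \<longlonglongrightarrow> 1" and "(\<lambda>n. q n ^ n) \<longlonglongrightarrow> 1"
    and "continuous_on {0..1} f"
  shows "stat_convergent_to
           (\<lambda>n. sup_norm01 (\<lambda>x. bernstein_stancu \<alpha> \<beta> (p n) (q n) n f x - f x)) 0"
proof (rule LIMSEQ_imp_stat_convergent_to, rule tendstoI)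
  define N where "N n = pq_int (p n) (q n) n" for n
  have "filterlim (\<lambda>n. q n ^ n * real n) at_top sequentially"
    using filterlim_tendsto_pos_mult_at_top[OF assms(8) _ filterlim_real_sequentially] by simp
  moreover have "eventually (\<lambda>n. q n ^ n * real n \<le> N n) sequentially"
    using eventually_ge_at_top[of 1]
  proof eventually_elim
    case (elim n)
    then show ?case
      using pq_int_lower_bound[of "q n" "p n" n] assms(3,4)[of n] by (simp add: N_def mult.commute)
  qed
  ultimately have "filterlim N at_top sequentially"
    by (rule filterlim_at_top_mono)
  then have inv: "(\<lambda>n. c / N n) \<longlonglongrightarrow> 0" for c
    by (rule real_tendsto_divide_at_top[OF tendsto_const])
  fix e :: real assume e: "e > 0"
  obtain C where C: "C \<ge> 0"
    "\<And>x y. x \<in> {0..1} \<Longrightarrow> y \<in> {0..1} \<Longrightarrow> \<bar>f y - f x\<bar> \<le> e / 2 + C * (y - x)\<^sup>2"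
    using continuous_quadratic_bound[OF assms(9), of "e / 2"] e by auto
  have "(\<lambda>n. e / 2 + C * (2 * (\<beta> / N n)\<^sup>2 + 2 / N n)) \<longlonglongrightarrow> e / 2 + C * (2 * 0\<^sup>2 + 0)"
    by (intro tendsto_intros inv)
  then have "eventually (\<lambda>n. e / 2 + C * (2 * (\<beta> / N n)\<^sup>2 + 2 / N n) < e) sequentially"
    by (rule order_tendstoD(2)) (use e in simp)
  with eventually_ge_at_top[of 1]
  show "eventually (\<lambda>n. dist (sup_norm01 (\<lambda>x. bernstein_stancu \<alpha> \<beta> (p n) (q n) n f x - f x)) 0 < e)
      sequentially"
  proof eventually_elim
    case (elim n)
    have "\<bar>sup_norm01 (\<lambda>x. bernstein_stancu \<alpha> \<beta> (p n) (q n) n f x - f x)\<bar>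
        \<le> e / 2 + C * (2 * (\<beta> / N n)\<^sup>2 + 2 / N n)"
      unfolding N_def
      using assms(1-2) assms(3,4)[OF elim(1)] elim(1) C
      by (intro abs_sup_norm01_le bernstein_stancu_error) auto
    then show ?case
      using elim(2) by (simp add: dist_real_def)
  qed
qed

end
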